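(* Let $\rho>0$ and let $f:\mathbb{R}^n\to\mathbb{R}$, $g:\mathbb{R}^n\to\mathbb{R}^m$, $h:\mathbb{R}^n\to\mathbb{R}^p$ be continuously differentiable. Let $(x^*,y^* )\in\mathbb{R}^n\times\mathbb{R}^n$ be feasible for (SPOlin) and (SPOsq), respectively, and assume $\{i\mid x_i^*=y_i^*=0\}=\emptyset$. Then the following are equivalent: (i) SP-LICQ is satisfied at $x^*$. (ii) Standard LICQ holds at $(x^*,y^* )$ for (SPOlin). (iii) Standard LICQ holds at $(x^*,y^* )$ for (SPOsq). Here "respectively" means: (i)$\Leftrightarrow$(ii) for every such $(x^*,y^* )$ feasible for (SPOlin), and (i)$\Leftrightarrow$(iii) for every such $(x^*,y^* )$ feasible for (SPOsq).
   Context: $X=\{x\in\mathbb{R}^n\mid g(x)\le 0,\ h(x)=0\}$; $e=(1,\dots,1)^T\in\mathbb{R}^n$; $e_i$ is the $i$-th unit vector of $\mathbb{R}^n$; $\circ$ is the componentwise product; $I_0(x)=\{i\mid x_i=0\}$; $I_g(x^* )=\{i\mid g_i(x^* )=0\}$. Problems: (SPOlin): $\min_{(x,y)} f(x)+\rho(n-e^Ty)$ s.t. $g(x)\le 0$, $h(x)=0$, $x\circ y=0$, $y\le e$. (SPOsq): $\min_{(x,y)} f(x)+\frac{\rho}{2}\sum_{i=1}^n y_i(y_i-2)$ s.t. $g(x)\le0$, $h(x)=0$, $x\circ y=0$. A point $x^*\in X$ satisfies SP-LICQ (sparse LICQ) if the vectors $\nabla g_i(x^* )$ $(i\in I_g(x^*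 ))$, $\nabla h_i(x^* )$ $(i=1,\dots,p)$, $e_i$ $(i\in I_0(x^* ))$ are linearly independent (as a family). Standard LICQ at a feasible point of a smooth nonlinear program means that the gradients (with respect to all variables, here $(x,y)$) of all equality constraints and all active inequality constraints are linearly independent (as a family). *)

theory Defs
  imports "HOL-Analysis.Analysis"
begin

definition gradient :: "('a::real_inner \<Rightarrow> real) \<Rightarrow> 'a \<Rightarrow> 'a" where
  "gradient f x = (THE D. GDERIV f x :> D)"

lemma gradient_eqI:
  assumes "GDERIV f x :> D"
  shows "gradient f x = D"
proof -
  have "D' = D" if "GDERIV f x :> D'" for D'
  proof -
    have "(\<lambda>h. inner h D') = (\<lambda>h. inner h D)"
      using that assms has_derivative_unique unfolding gderiv_def by blast
    then have "\<forall>h. inner h (D' - D) = 0"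
      by (metis inner_diff_right diff_self)
    then show ?thesis
      by (metis inner_eq_zero_iff eq_iff_diff_eq_0)
  qed
  with assms show ?thesis
    unfolding gradient_def by blast
qed

definition cont_diff :: "('a::real_inner \<Rightarrow> real) \<Rightarrow> bool" where
  "cont_diff f \<longleftrightarrow> (\<exists>G. (\<forall>x. GDERIV f x :> G x) \<and> continuous_on UNIV G)"

text \<open>Linear independence of a family rather than of its range: a repeated vector makes
  the family dependent.\<close>

definition lin_indep_family :: "'i set \<Rightarrow> ('i \<Rightarrow> 'a::real_vector) \<Rightarrow> bool" where
  "lin_indep_family I v \<longleftrightarrow> inj_on v I \<and> independent (v ` I)"

lemma lin_indep_family_iff:
  assumes "finite I"
  shows "lin_indep_family I v \<longleftrightarrow>
    (\<forall>c. (\<Sum>i\<in>I. c i *\<^sub>R v i) = 0 \<longrightarrow> (\<forall>i\<in>I. c i = 0))"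
proof (intro iffI allI impI)
  fix c :: "'a \<Rightarrow> real" and d
  assume "lin_indep_family I v" and s: "(\<Sum>i\<in>I. d i *\<^sub>R v i) = 0"
  then have inj: "inj_on v I" and ind: "independent (v ` I)"
    by (auto simp: lin_indep_family_def)
  have "(\<Sum>w\<in>v ` I. d (inv_into I v w) *\<^sub>R w) = 0"
    using s inj by (simp add: sum.reindex)
  then have "\<forall>w\<in>v ` I. d (inv_into I v w) = 0"
    using independentD[OF ind, of "v ` I" "\<lambda>w. d (inv_into I v w)"] assms by simp
  then show "\<forall>i\<in>I. d i = 0"
    using inj by simp
next
  assume R: "\<forall>c. (\<Sum>i\<in>I. c i *\<^sub>R v i) = 0 \<longrightarrow> (\<forall>i\<in>I. c i = 0)"
  have inj: "inj_on v I"
  proof (rule inj_onI, rule ccontr)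
    fix i j assume ij: "i \<in> I" "j \<in> I" "v i = v j" "i \<noteq> j"
    define c where "c k = (if k = i then 1 else 0) - (if k = j then 1 else (0::real))" for k
    have "(\<Sum>k\<in>I. c k *\<^sub>R v k) = v i - v j"
      using ij assms
      by (simp add: c_def scaleR_left_diff_distrib sum_subtractf if_distrib[of "\<lambda>r. r *\<^sub>R _"]
          cong: if_cong)
    with R ij have "c i = 0" by simp
    with ij show False by (simp add: c_def)
  qed
  moreover have "independent (v ` I)"
  proof (rule independent_if_scalars_zero)
    fix u w assume s: "(\<Sum>w\<in>v ` I. u w *\<^sub>R w) = 0" and w: "w \<in> v ` I"
    have "(\<Sum>i\<in>I. u (v i) *\<^sub>R v i) = 0"
      using s inj by (simp add: sum.reindex)
    with R[rule_format, of "\<lambda>i. u (v i)"] w show "u w = 0"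
      by blast
  qed (use assms in simp)
  ultimately show "lin_indep_family I v"
    by (simp add: lin_indep_family_def)
qed

text \<open>Minimize the objective subject to \<open>ineq_con P i z \<le> 0\<close> for \<open>i \<in> ineq_index P\<close> and
  \<open>eq_con P j z = 0\<close> for \<open>j \<in> eq_index P\<close>.\<close>

record ('a, 'i, 'j) nlp =
  objective :: "'a \<Rightarrow> real"
  ineq_index :: "'i set"
  ineq_con :: "'i \<Rightarrow> 'a \<Rightarrow> real"
  eq_index :: "'j set"
  eq_con :: "'j \<Rightarrow> 'a \<Rightarrow> real"

definition feasible :: "('a, 'i, 'j) nlp \<Rightarrow> 'a \<Rightarrow> bool" where
  "feasible P z \<longleftrightarrow>
    (\<forall>i\<in>ineq_index P. ineq_con P i z \<le> 0) \<and> (\<forall>j\<in>eq_index P. eq_con P j z = 0)"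

definition active_set :: "('a, 'i, 'j) nlp \<Rightarrow> 'a \<Rightarrow> 'i set" where
  "active_set P z = {i \<in> ineq_index P. ineq_con P i z = 0}"

definition LICQ :: "('a::real_inner, 'i, 'j) nlp \<Rightarrow> 'a \<Rightarrow> bool" where
  "LICQ P z \<longleftrightarrow> feasible P z \<and>
    lin_indep_family (active_set P z <+> eq_index P)
      (case_sum (\<lambda>i. gradient (ineq_con P i) z) (\<lambda>j. gradient (eq_con P j) z))"

text \<open>The maps \<open>g\<close> and \<open>h\<close> into \<open>m\<close>- and \<open>p\<close>-dimensional space are given by their components
  \<open>g i\<close>, \<open>i \<in> {1..m}\<close>, and \<open>h j\<close>, \<open>j \<in> {1..p}\<close>, so that \<open>m = 0\<close> and \<open>p = 0\<close> (no such
  constraints) are allowed.\<close>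

definition feas_X ::
    "nat \<Rightarrow> nat \<Rightarrow> (nat \<Rightarrow> real^'n \<Rightarrow> real) \<Rightarrow> (nat \<Rightarrow> real^'n \<Rightarrow> real) \<Rightarrow> (real^'n) set" where
  "feas_X m p g h = {x. (\<forall>i\<in>{1..m}. g i x \<le> 0) \<and> (\<forall>j\<in>{1..p}. h j x = 0)}"

definition I_0 :: "real^'n \<Rightarrow> 'n set" where
  "I_0 x = {i. x $ i = 0}"

definition I_g :: "nat \<Rightarrow> (nat \<Rightarrow> real^'n \<Rightarrow> real) \<Rightarrow> real^'n \<Rightarrow> nat set" where
  "I_g m g x = {i \<in> {1..m}. g i x = 0}"

definition SP_LICQ ::
    "nat \<Rightarrow> nat \<Rightarrow> (nat \<Rightarrow> real^'n \<Rightarrow> real) \<Rightarrow> (nat \<Rightarrow> real^'n \<Rightarrow> real) \<Rightarrow> real^'n \<Rightarrow> bool" where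
  "SP_LICQ m p g h x \<longleftrightarrow> x \<in> feas_X m p g h \<and>
    lin_indep_family (I_g m g x <+> ({1..p} <+> I_0 x))
      (case_sum (\<lambda>i. gradient (g i) x) (case_sum (\<lambda>j. gradient (h j) x) (\<lambda>k. axis k 1)))"

text \<open>In both problems an index \<open>Inr k\<close> with \<open>k :: 'n\<close> refers to the \<open>k\<close>-th component of the
  vector constraint \<open>y \<le> e\<close> (inequalities) or \<open>x \<circ> y = 0\<close> (equalities).
  The vector \<open>e\<close> is \<open>1 :: real^'n\<close>.\<close>

definition SPOlin ::
    "real \<Rightarrow> (real^'n \<Rightarrow> real) \<Rightarrow> nat \<Rightarrow> nat \<Rightarrow> (nat \<Rightarrow> real^'n \<Rightarrow> real) \<Rightarrow> (nat \<Rightarrow> real^'n \<Rightarrow> real) \<Rightarrow>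
      ((real^'n) \<times> (real^'n), nat + 'n, nat + 'n) nlp" where
  "SPOlin \<rho> f m p g h = \<lparr>
     objective = (\<lambda>(x, y). f x + \<rho> * (real CARD('n) - 1 \<bullet> y)),
     ineq_index = {1..m} <+> UNIV,
     ineq_con = case_sum (\<lambda>i (x, y). g i x) (\<lambda>k (x, y). y $ k - 1),
     eq_index = {1..p} <+> UNIV,
     eq_con = case_sum (\<lambda>j (x, y). h j x) (\<lambda>k (x, y). x $ k * y $ k)\<rparr>"

definition SPOsq ::
    "real \<Rightarrow> (real^'n \<Rightarrow> real) \<Rightarrow> nat \<Rightarrow> nat \<Rightarrow> (nat \<Rightarrow> real^'n \<Rightarrow> real) \<Rightarrow> (nat \<Rightarrow> real^'n \<Rightarrow> real) \<Rightarrow>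
      ((real^'n) \<times> (real^'n), nat, nat + 'n) nlp" where
  "SPOsq \<rho> f m p g h = \<lparr>
     objective = (\<lambda>(x, y). f x + \<rho> / 2 * (\<Sum>k\<in>UNIV. y $ k * (y $ k - 2))),
     ineq_index = {1..m},
     ineq_con = (\<lambda>i (x, y). g i x),
     eq_index = {1..p} <+> UNIV,
     eq_con = case_sum (\<lambda>j (x, y). h j x) (\<lambda>k (x, y). x $ k * y $ k)\<rparr>"

end

theory Submission
  imports Defs
begin

text \<open>With respect to \<open>(x, y)\<close>, the gradients of \<open>g i\<close> and \<open>h j\<close> are \<open>(\<nabla>g i x, 0)\<close> and
  \<open>(\<nabla>h j x, 0)\<close>, that of \<open>y $ k - 1\<close> is \<open>(0, e\<^sub>k)\<close>, and that of \<open>x $ k * y $ k\<close> is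
  \<open>(y\<^sub>k e\<^sub>k, x\<^sub>k e\<^sub>k)\<close>. Under the hypotheses exactly one of \<open>x\<^sub>k\<close>, \<open>y\<^sub>k\<close> vanishes, so the last
  gradient is a nonzero multiple of \<open>(e\<^sub>k, 0)\<close> if \<open>k \<in> I_0 x\<close>, and of \<open>(0, e\<^sub>k)\<close> otherwise.
  An active bound \<open>y\<^sub>k = 1\<close> forces \<open>x\<^sub>k = 0\<close>. Hence the gradients with vanishing
  first block are nonzero multiples of distinct unit vectors \<open>(0, e\<^sub>k)\<close>. They are independent of
  each other and of the rest, and the rest is, up to nonzero factors, the SP-LICQ family in the
  first block.

  This is \<open>lin_indep_family_complementarity\<close>, formulated for an arbitrary set \<open>B \<subseteq> I_0 x\<close> of
  active bounds: \<open>B = {k. y $ k = 1}\<close> gives the linear reformulation, \<open>B = {}\<close> the quadratic one.\<close>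

section \<open>Gradients on the product space\<close>

lemma gradient_fst_comp:
  assumes "cont_diff \<phi>"
  shows "gradient (\<lambda>(x, y). \<phi> x) (x, y :: 'b::real_inner) = (gradient \<phi> x, 0)"
proof -
  obtain D where D: "GDERIV \<phi> x :> D"
    using assms unfolding cont_diff_def by blast
  have "((\<lambda>z. \<phi> (fst z)) has_derivative (\<lambda>d. fst d \<bullet> D)) (at (x, y))"
    by (rule has_derivative_compose[where f = fst and g = \<phi>])
      (use D in \<open>auto simp: gderiv_def intro!: derivative_eq_intros\<close>)
  then have "GDERIV (\<lambda>(x, y). \<phi> x) (x, y) :> (D, 0)"
    by (simp add: gderiv_def case_prod_beta' inner_prod_def)
  with gradient_eqI[OF D] show ?thesis
    by (simp add: gradient_eqI)
qed

lemma gradient_snd_nth_minus: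
  "gradient (\<lambda>(x :: 'a::real_inner, y). y $ k - c) (x, y :: real^'n) = (0, axis k 1)"
proof (rule gradient_eqI)
  have "((\<lambda>z :: 'a \<times> (real^'n). snd z $ k - c) has_derivative (\<lambda>d. snd d $ k)) (at (x, y))"
    by (auto intro!: derivative_eq_intros bounded_linear_imp_has_derivative
      bounded_linear_compose[OF bounded_linear_vec_nth bounded_linear_fst]
      bounded_linear_compose[OF bounded_linear_vec_nth bounded_linear_snd])
  then show "GDERIV (\<lambda>(x :: 'a, y). y $ k - c) (x, y) :> (0, axis k 1)"
    by (simp add: gderiv_def case_prod_beta' inner_prod_def inner_axis)
qed

lemma gradient_nth_mult_nth:
  "gradient (\<lambda>(x, y). x $ k * y $ k) (x :: real^'n, y :: real^'n)
    = (axis k (y $ k), axis k (x $ k))"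
proof (rule gradient_eqI)
  have "((\<lambda>z :: (real^'n) \<times> (real^'n). fst z $ k * snd z $ k) has_derivative
      (\<lambda>d. fst d $ k * y $ k + snd d $ k * x $ k)) (at (x, y))"
    by (auto intro!: derivative_eq_intros bounded_linear_imp_has_derivative
      bounded_linear_compose[OF bounded_linear_vec_nth bounded_linear_fst]
      bounded_linear_compose[OF bounded_linear_vec_nth bounded_linear_snd])
  then show "GDERIV (\<lambda>(x, y). x $ k * y $ k) (x, y) :> (axis k (y $ k), axis k (x $ k))"
    by (simp add: gderiv_def case_prod_beta' inner_prod_def inner_axis)
qed

section \<open>Linear independence of families\<close>

lemma lin_indep_family_cong:
  assumes "\<And>i. i \<in> I \<Longrightarrow> v i = w i"
  shows "lin_indep_family I v \<longleftrightarrow> lin_indep_family I w"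
  using assms inj_on_cong[of I v w] image_cong[of I I v w] by (simp add: lin_indep_family_def)

lemma lin_indep_family_reindex:
  assumes "inj_on f I"
  shows "lin_indep_family (f ` I) v \<longleftrightarrow> lin_indep_family I (v \<circ> f)"
  using comp_inj_on_iff[OF assms, of v] by (simp add: lin_indep_family_def image_comp)

lemma lin_indep_family_complementarity:
  fixes G :: "'i \<Rightarrow> real^'n" and H :: "'j \<Rightarrow> real^'n" and x y :: "real^'n"
  assumes fin: "finite A" "finite J"
    and B: "B \<subseteq> I_0 x"
    and compl: "\<And>k. x $ k = 0 \<longleftrightarrow> y $ k \<noteq> 0"
  shows "lin_indep_family (A <+> (J <+> I_0 x)) (case_sum G (case_sum H (\<lambda>k. axis k 1)))
    \<longleftrightarrow> lin_indep_family ((A <+> B) <+> (J <+> UNIV))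
      (case_sum (case_sum (\<lambda>i. (G i, 0)) (\<lambda>k. (0, axis k 1)))
        (case_sum (\<lambda>j. (H j, 0)) (\<lambda>k. (axis k (y $ k), axis k (x $ k)))))"
    (is "lin_indep_family ?I ?v \<longleftrightarrow> lin_indep_family ?K ?w")
proof
  have finI: "finite ?I" and finK: "finite ?K"
    using fin by simp_all
  have sumI: "(\<Sum>i\<in>?I. c i *\<^sub>R ?v i) = (\<Sum>i\<in>A. c (Inl i) *\<^sub>R G i) +
      ((\<Sum>j\<in>J. c (Inr (Inl j)) *\<^sub>R H j) + (\<Sum>k\<in>I_0 x. c (Inr (Inr k)) *\<^sub>R axis k 1))" for c
    using fin by (simp add: sum.Plus)
  have sumK: "(\<Sum>i\<in>?K. c i *\<^sub>R ?w i) =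
      ((\<Sum>i\<in>A. c (Inl (Inl i)) *\<^sub>R G i) +
        ((\<Sum>j\<in>J. c (Inr (Inl j)) *\<^sub>R H j) + (\<Sum>k\<in>UNIV. c (Inr (Inr k)) *\<^sub>R axis k (y $ k))),
       (\<Sum>k\<in>B. c (Inl (Inr k)) *\<^sub>R axis k 1) + (\<Sum>k\<in>UNIV. c (Inr (Inr k)) *\<^sub>R axis k (x $ k)))"
    for c
    using fin by (simp add: sum.Plus prod_eq_iff fst_sum snd_sum)
  \<comment> \<open>Outside \<open>I_0 x\<close> the factor \<open>y $ k\<close> vanishes.\<close>
  have restrict: "(\<Sum>k\<in>UNIV. d k *\<^sub>R axis k (y $ k))
      = (\<Sum>k\<in>I_0 x. (d k * y $ k) *\<^sub>R axis k (1::real))" for d :: "'n \<Rightarrow> real"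
  proof -
    have "(\<Sum>k\<in>UNIV. d k *\<^sub>R axis k (y $ k)) = (\<Sum>k\<in>I_0 x. d k *\<^sub>R axis k (y $ k))"
      by (rule sum.mono_neutral_right) (use compl in \<open>auto simp: I_0_def\<close>)
    also have "\<dots> = (\<Sum>k\<in>I_0 x. (d k * y $ k) *\<^sub>R axis k (1::real))"
      by (intro sum.cong refl) (simp add: vec_eq_iff axis_def)
    finally show ?thesis .
  qed
  {
    assume L: "lin_indep_family ?I ?v"
    show "lin_indep_family ?K ?w"
      unfolding lin_indep_family_iff[OF finK]
    proof (intro allI impI)
      fix c
      assume "(\<Sum>i\<in>?K. c i *\<^sub>R ?w i) = 0"
      then have fst0: "(\<Sum>i\<in>A. c (Inl (Inl i)) *\<^sub>R G i) + ((\<Sum>j\<in>J. c (Inr (Inl j)) *\<^sub>R H j) +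
            (\<Sum>k\<in>I_0 x. (c (Inr (Inr k)) * y $ k) *\<^sub>R axis k 1)) = 0"
        and snd0: "(\<Sum>k\<in>B. c (Inl (Inr k)) *\<^sub>R axis k 1) +
            (\<Sum>k\<in>UNIV. c (Inr (Inr k)) *\<^sub>R axis k (x $ k)) = (0 :: real^'n)"
        unfolding sumK restrict by (simp_all add: prod_eq_iff)
      have coord: "(if k \<in> B then c (Inl (Inr k)) else 0) + c (Inr (Inr k)) * x $ k = 0" for k
        using arg_cong[OF snd0, of "\<lambda>z. z $ k"]
        by (simp add: axis_def if_distrib[of "\<lambda>r. _ * r"] cong: if_cong)
      define d where "d = case_sum (\<lambda>i. c (Inl (Inl i)))
        (case_sum (\<lambda>j. c (Inr (Inl j))) (\<lambda>k. c (Inr (Inr k)) * y $ k))"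
      have "(\<Sum>i\<in>?I. d i *\<^sub>R ?v i) = 0"
        unfolding sumI using fst0 by (simp add: d_def)
      then have d0: "\<forall>i\<in>?I. d i = 0"
        using L by (simp add: lin_indep_family_iff[OF finI])
      have "c (Inl (Inl i)) = 0" if "i \<in> A" for i
        using bspec[OF d0 InlI[OF that]] by (simp add: d_def)
      moreover have "c (Inr (Inl j)) = 0" if "j \<in> J" for j
        using bspec[OF d0 InrI[OF InlI[OF that]]] by (simp add: d_def)
      moreover have "c (Inr (Inr k)) = 0" for k
      proof (cases "k \<in> I_0 x")
        case True
        then show ?thesis
          using bspec[OF d0 InrI[OF InrI[OF True]]] compl[of k] by (simp add: d_def I_0_def)
      next
        case False
        then have "k \<notin> B"
          using B by blast
        with False show ?thesis
          using coord[of k] by (simp add: I_0_def)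
      qed
      moreover have "c (Inl (Inr k)) = 0" if "k \<in> B" for k
        using coord[of k] that B by (auto simp: I_0_def)
      ultimately show "\<forall>i\<in>?K. c i = 0"
        by auto
    qed
  }
  {
    assume L: "lin_indep_family ?K ?w"
    show "lin_indep_family ?I ?v"
      unfolding lin_indep_family_iff[OF finI]
    proof (intro allI impI)
      fix c
      assume c: "(\<Sum>i\<in>?I. c i *\<^sub>R ?v i) = 0"
      \<comment> \<open>Outside \<open>I_0 x\<close> the divisor \<open>y $ k\<close> is 0, so these coefficients are 0.\<close>
      define d where "d = case_sum (case_sum (\<lambda>i. c (Inl i)) (\<lambda>k :: 'n. 0))
        (case_sum (\<lambda>j. c (Inr (Inl j))) (\<lambda>k. c (Inr (Inr k)) / y $ k))"
      have "(\<Sum>k\<in>I_0 x. (c (Inr (Inr k)) / y $ k * y $ k) *\<^sub>R axis k (1::real))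
          = (\<Sum>k\<in>I_0 x. c (Inr (Inr k)) *\<^sub>R axis k 1)"
        by (intro sum.cong refl) (use compl in \<open>auto simp: I_0_def\<close>)
      moreover have "(\<Sum>k\<in>UNIV. (c (Inr (Inr k)) / y $ k) *\<^sub>R axis k (x $ k)) = (0 :: real^'n)"
        by (intro sum.neutral ballI) (use compl in \<open>auto simp: vec_eq_iff axis_def\<close>)
      ultimately have "(\<Sum>i\<in>?K. d i *\<^sub>R ?w i) = 0"
        unfolding sumK restrict using c unfolding sumI by (simp add: d_def zero_prod_def)
      then have d0: "\<forall>i\<in>?K. d i = 0"
        using L by (simp add: lin_indep_family_iff[OF finK])
      have "c (Inl i) = 0" if "i \<in> A" for i
        using bspec[OF d0 InlI[OF InlI[OF that]]] by (simp add: d_def)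
      moreover have "c (Inr (Inl j)) = 0" if "j \<in> J" for j
        using bspec[OF d0 InrI[OF InlI[OF that]]] by (simp add: d_def)
      moreover have "c (Inr (Inr k)) = 0" if "k \<in> I_0 x" for k
        using bspec[OF d0 InrI[OF InrI[OF UNIV_I]], of k] that compl[of k] by (simp add: d_def I_0_def)
      ultimately show "\<forall>i\<in>?I. c i = 0"
        by auto
    qed
  }
qed

section \<open>The two reformulations\<close>

lemma ball_Plus: "(\<forall>s\<in>A <+> B. P s) \<longleftrightarrow> (\<forall>a\<in>A. P (Inl a)) \<and> (\<forall>b\<in>B. P (Inr b))"
  by blast

lemma SP_LICQ_iff_LICQ_SPOlin:
  fixes g h :: "nat \<Rightarrow> real^'n \<Rightarrow> real"
  assumes g: "\<And>i. i \<in> {1..m} \<Longrightarrow> cont_diff (g i)"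
    and h: "\<And>j. j \<in> {1..p} \<Longrightarrow> cont_diff (h j)"
    and feas: "feasible (SPOlin \<rho> f m p g h) (x, y)"
    and nobi: "{i. x $ i = 0 \<and> y $ i = 0} = {}"
  shows "SP_LICQ m p g h x \<longleftrightarrow> LICQ (SPOlin \<rho> f m p g h) (x, y)"
proof -
  let ?P = "SPOlin \<rho> f m p g h"
  let ?B = "{k. y $ k = 1}"
  have X: "x \<in> feas_X m p g h"
    using feas by (simp add: feasible_def SPOlin_def feas_X_def ball_Plus)
  have xy: "x $ k * y $ k = 0" for k
    using feas by (simp add: feasible_def SPOlin_def ball_Plus)
  have compl: "x $ k = 0 \<longleftrightarrow> y $ k \<noteq> 0" for k
    using xy[of k] nobi by auto
  have B: "?B \<subseteq> I_0 x"
    by (simp add: I_0_def compl subset_eq)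
  have index: "active_set ?P (x, y) <+> eq_index ?P = (I_g m g x <+> ?B) <+> ({1..p} <+> UNIV)"
    by (auto simp: active_set_def SPOlin_def I_g_def)
  have "lin_indep_family ((I_g m g x <+> ?B) <+> ({1..p} <+> UNIV))
      (case_sum (\<lambda>i. gradient (ineq_con ?P i) (x, y)) (\<lambda>j. gradient (eq_con ?P j) (x, y)))
    \<longleftrightarrow> lin_indep_family ((I_g m g x <+> ?B) <+> ({1..p} <+> UNIV))
      (case_sum (case_sum (\<lambda>i. (gradient (g i) x, 0)) (\<lambda>k. (0, axis k 1)))
        (case_sum (\<lambda>j. (gradient (h j) x, 0)) (\<lambda>k. (axis k (y $ k), axis k (x $ k)))))"
    by (rule lin_indep_family_cong)
      (use g h in \<open>auto simp: SPOlin_def I_g_def gradient_fst_comp gradient_snd_nth_minus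
        gradient_nth_mult_nth\<close>)
  also have "\<dots> \<longleftrightarrow> lin_indep_family (I_g m g x <+> ({1..p} <+> I_0 x))
      (case_sum (\<lambda>i. gradient (g i) x) (case_sum (\<lambda>j. gradient (h j) x) (\<lambda>k. axis k 1)))"
    by (rule lin_indep_family_complementarity[OF _ _ B compl, symmetric]) (simp_all add: I_g_def)
  finally show ?thesis
    using X feas by (simp add: SP_LICQ_def LICQ_def index)
qed

lemma SP_LICQ_iff_LICQ_SPOsq:
  fixes g h :: "nat \<Rightarrow> real^'n \<Rightarrow> real"
  assumes g: "\<And>i. i \<in> {1..m} \<Longrightarrow> cont_diff (g i)"
    and h: "\<And>j. j \<in> {1..p} \<Longrightarrow> cont_diff (h j)"
    and feas: "feasible (SPOsq \<rho> f m p g h) (x, y)"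
    and nobi: "{i. x $ i = 0 \<and> y $ i = 0} = {}"
  shows "SP_LICQ m p g h x \<longleftrightarrow> LICQ (SPOsq \<rho> f m p g h) (x, y)"
proof -
  let ?P = "SPOsq \<rho> f m p g h"
  let ?K = "I_g m g x <+> ({1..p} <+> (UNIV :: 'n set))"
  let ?emb = "map_sum Inl id :: nat + (nat + 'n) \<Rightarrow> (nat + 'n) + (nat + 'n)"
  let ?w = "case_sum (case_sum (\<lambda>i. (gradient (g i) x, 0)) (\<lambda>k. (0, axis k 1)))
    (case_sum (\<lambda>j. (gradient (h j) x, 0)) (\<lambda>k. (axis k (y $ k), axis k (x $ k))))"
  have X: "x \<in> feas_X m p g h"
    using feas by (simp add: feasible_def SPOsq_def feas_X_def ball_Plus)
  have xy: "x $ k * y $ k = 0" for k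
    using feas by (simp add: feasible_def SPOsq_def ball_Plus)
  have compl: "x $ k = 0 \<longleftrightarrow> y $ k \<noteq> 0" for k
    using xy[of k] nobi by auto
  have index: "active_set ?P (x, y) <+> eq_index ?P = ?K"
    by (auto simp: active_set_def SPOsq_def I_g_def)
  \<comment> \<open>\<open>?emb\<close> identifies the index set with that of the linear reformulation without active
    bounds.\<close>
  have inj: "inj_on ?emb ?K"
    by (auto simp: inj_on_def)
  have emb: "?emb ` ?K = (I_g m g x <+> {}) <+> ({1..p} <+> UNIV)"
    by (simp add: Plus_def image_Un image_image)
  have "lin_indep_family ?K
      (case_sum (\<lambda>i. gradient (ineq_con ?P i) (x, y)) (\<lambda>j. gradient (eq_con ?P j) (x, y)))
    \<longleftrightarrow> lin_indep_family ?K (?w \<circ> ?emb)"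
    by (rule lin_indep_family_cong)
      (use g h in \<open>auto simp: SPOsq_def I_g_def gradient_fst_comp gradient_nth_mult_nth\<close>)
  also have "\<dots> \<longleftrightarrow> lin_indep_family ((I_g m g x <+> {}) <+> ({1..p} <+> UNIV)) ?w"
    using lin_indep_family_reindex[OF inj, of ?w] unfolding emb by simp
  also have "\<dots> \<longleftrightarrow> lin_indep_family (I_g m g x <+> ({1..p} <+> I_0 x))
      (case_sum (\<lambda>i. gradient (g i) x) (case_sum (\<lambda>j. gradient (h j) x) (\<lambda>k. axis k 1)))"
    by (rule lin_indep_family_complementarity[OF _ _ _ compl, symmetric]) (simp_all add: I_g_def)
  finally show ?thesis
    using X feas by (simp add: SP_LICQ_def LICQ_def index)
qed

theorem theorem4p5:
  fixes \<rho> :: real and f :: "real^'n \<Rightarrow> real" and m p :: nat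
    and g h :: "nat \<Rightarrow> real^'n \<Rightarrow> real"
  assumes "\<rho> > 0"
    and "cont_diff f"
    and "\<And>i. i \<in> {1..m} \<Longrightarrow> cont_diff (g i)"
    and "\<And>j. j \<in> {1..p} \<Longrightarrow> cont_diff (h j)"
  shows "(\<forall>x y. feasible (SPOlin \<rho> f m p g h) (x, y) \<and> {i. x $ i = 0 \<and> y $ i = 0} = {} \<longrightarrow>
            (SP_LICQ m p g h x \<longleftrightarrow> LICQ (SPOlin \<rho> f m p g h) (x, y)))
       \<and> (\<forall>x y. feasible (SPOsq \<rho> f m p g h) (x, y) \<and> {i. x $ i = 0 \<and> y $ i = 0} = {} \<longrightarrow>
            (SP_LICQ m p g h x \<longleftrightarrow> LICQ (SPOsq \<rho> f m p g h) (x, y)))"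
proof (intro conjI allI impI; elim conjE)
  fix x y :: "real^'n"
  assume nobi: "{i. x $ i = 0 \<and> y $ i = 0} = {}"
  show "SP_LICQ m p g h x \<longleftrightarrow> LICQ (SPOlin \<rho> f m p g h) (x, y)"
    if "feasible (SPOlin \<rho> f m p g h) (x, y)"
    by (rule SP_LICQ_iff_LICQ_SPOlin[OF _ _ that nobi]) (use assms in simp_all)
  show "SP_LICQ m p g h x \<longleftrightarrow> LICQ (SPOsq \<rho> f m p g h) (x, y)"
    if "feasible (SPOsq \<rho> f m p g h) (x, y)"
    by (rule SP_LICQ_iff_LICQ_SPOsq[OF _ _ that nobi]) (use assms in simp_all)
qed

end
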